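(* Let $n, k, \ell$ be positive integers with $n \geq k\ell$, $\ell \geq 2$, and $k \geq 3$. If $\mathcal{P}$ is an intersecting family of $(k,\ell)$-subpartitions of $[n]$, then $$|\mathcal{P}| \leq \frac{1}{(\ell-1)!} \prod_{i=1}^{\ell-1}\binom{n-ik}{k}.$$ Moreover, this bound is attained only by a canonical intersecting family of $(k,\ell)$-subpartitions, i.e. a family consisting of all $(k,\ell)$-subpartitions of $[n]$ that contain a fixed $k$-subset of $[n]$ as one of their classes.
   Context: Let $[n]=\{1,\dots,n\}$. A $(k,\ell)$-subpartition of $[n]$ is a set $P=\{P_1,\dots,P_\ell\}$ of $\ell$ pairwise disjoint $k$-subsets of $[n]$ (called classes); thus $|\bigcup_i P_i| = k\ell$. Two $(k,\ell)$-subpartitions $P=\{P_1,\dots,P_\ell\}$ and $Q=\{Q_1,\dots,Q_\ell\}$ are intersecting if $P_i=Q_j$ for some $i,j$, i.e. they have a common class. A family is intersecting if every two of its members are intersecting. *)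

theory Defs
  imports Complex_Main
begin

definition subpartition :: "nat \<Rightarrow> nat \<Rightarrow> nat \<Rightarrow> nat set set \<Rightarrow> bool" where
  "subpartition n k l P \<longleftrightarrow>
     card P = l \<and> (\<forall>A\<in>P. A \<subseteq> {1..n} \<and> card A = k) \<and> pairwise disjnt P"

definition intersecting_subpartitions :: "nat set set \<Rightarrow> nat set set \<Rightarrow> bool" where
  "intersecting_subpartitions P Q \<longleftrightarrow> (\<exists>A\<in>P. \<exists>B\<in>Q. A = B)"

definition intersecting_family :: "nat set set set \<Rightarrow> bool" where
  "intersecting_family F \<longleftrightarrow> (\<forall>P\<in>F. \<forall>Q\<in>F. intersecting_subpartitions P Q)"

definition canonical_family :: "nat \<Rightarrow> nat \<Rightarrow> nat \<Rightarrow> nat set set set \<Rightarrow> bool" where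
  "canonical_family n k l F \<longleftrightarrow>
     (\<exists>A. A \<subseteq> {1..n} \<and> card A = k \<and> F = {P. subpartition n k l P \<and> A \<in> P})"

end

theory Submission
  imports Defs
begin

text \<open>
  Suppose that no class is common to all members of the intersecting family. Given a class \<open>A\<close>,
  choose a member \<open>Q\<close> that avoids \<open>A\<close>; every member containing \<open>A\<close> must also contain one of the
  \<open>d\<close> classes of \<open>Q\<close> disjoint from \<open>A\<close>. Letting \<open>A\<close> range over the \<open>l\<close> classes of one member, the
  family has at most \<open>l * d * N\<close> elements, where \<open>N\<close> counts the subpartitions with two prescribed
  classes. A canonical family has \<open>((n - k) choose k) * N / (l - 1)\<close> elements, which is strictly
  larger: \<open>d \<le> l\<close> suffices for this when \<open>n \<ge> k * l + 2\<close>, while \<open>d \<le> l - 1\<close> when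
  \<open>n = k * l + 1\<close>, and \<open>d \<le> l - 2\<close> when \<open>n = k * l\<close>.
\<close>

section \<open>Counting subpartitions with prescribed classes\<close>

text \<open>The ground set is arbitrary, so that deleting a class \<open>A\<close> leaves an object
  of the same kind over \<open>S - A\<close>.\<close>

definition subpartitions :: "'a set \<Rightarrow> nat \<Rightarrow> nat \<Rightarrow> 'a set set set" where
  "subpartitions S k l =
     {P. card P = l \<and> (\<forall>A\<in>P. A \<subseteq> S \<and> card A = k) \<and> pairwise disjnt P}"

lemma subpartition_iff: "subpartition n k l P \<longleftrightarrow> P \<in> subpartitions {1..n} k l"
  by (simp add: subpartition_def subpartitions_def)

lemma finite_subpartitions: "finite S \<Longrightarrow> finite (subpartitions S k l)"
  by (rule finite_subset[of _ "Pow (Pow S)"]) (auto simp: subpartitions_def)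

lemma finite_subpartition: "finite S \<Longrightarrow> P \<in> subpartitions S k l \<Longrightarrow> finite P"
  by (rule finite_subset[of _ "Pow S"]) (auto simp: subpartitions_def)

text \<open>Deleting \<open>A\<close> is a bijection with inverse \<open>insert A\<close>. The set
  \<open>X\<close> holds further prescribed classes: it is later empty or a singleton.\<close>

lemma card_subpartitions_containing:
  fixes S :: "'a set"
  assumes "finite S" "k > 0" "A \<subseteq> S" "card A = k"
  shows "card {P \<in> subpartitions S k (Suc l). A \<in> P \<and> X \<subseteq> P - {A}}
       = card {P \<in> subpartitions (S - A) k l. X \<subseteq> P}"
proof (rule bij_betw_same_card[of "\<lambda>P. P - {A}"],
       rule bij_betw_byWitness[where f' = "insert A"])
  \<comment> \<open>A nonempty \<open>A\<close> cannot be a subset of \<open>S - A\<close>, so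
    \<open>insert A\<close> really adds a class.\<close>
  have "A \<noteq> {}" using assms by auto
  have notin: "A \<notin> P" if "P \<in> subpartitions (S - A) k l" for P
    using that \<open>A \<noteq> {}\<close> by (auto simp: subpartitions_def)
  show "\<forall>P\<in>{P \<in> subpartitions S k (Suc l). A \<in> P \<and> X \<subseteq> P - {A}}. insert A (P - {A}) = P"
    by auto
  show "\<forall>P\<in>{P \<in> subpartitions (S - A) k l. X \<subseteq> P}. insert A P - {A} = P"
    using notin by auto
  show "(\<lambda>P. P - {A}) ` {P \<in> subpartitions S k (Suc l). A \<in> P \<and> X \<subseteq> P - {A}}
      \<subseteq> {P \<in> subpartitions (S - A) k l. X \<subseteq> P}"
  proof (rule image_subsetI)
    fix P assume "P \<in> {P \<in> subpartitions S k (Suc l). A \<in> P \<and> X \<subseteq> P - {A}}"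
    then have P: "P \<in> subpartitions S k (Suc l)" "A \<in> P" "X \<subseteq> P - {A}" by auto
    have "B \<subseteq> S - A" if "B \<in> P - {A}" for B
    proof -
      have "disjnt B A" using P that by (auto simp: subpartitions_def pairwise_def)
      then show ?thesis using P that by (auto simp: subpartitions_def disjnt_iff)
    qed
    then show "P - {A} \<in> {P \<in> subpartitions (S - A) k l. X \<subseteq> P}"
      using P finite_subpartition[OF assms(1) P(1)]
      by (auto simp: subpartitions_def intro: pairwise_mono)
  qed
  show "insert A ` {P \<in> subpartitions (S - A) k l. X \<subseteq> P}
      \<subseteq> {P \<in> subpartitions S k (Suc l). A \<in> P \<and> X \<subseteq> P - {A}}"
  proof (rule image_subsetI)
    fix P assume "P \<in> {P \<in> subpartitions (S - A) k l. X \<subseteq> P}"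
    then have P: "P \<in> subpartitions (S - A) k l" "X \<subseteq> P" by auto
    have "finite P" using finite_subpartition P assms(1) by blast
    moreover have "\<forall>B\<in>P. disjnt A B" using P by (auto simp: subpartitions_def disjnt_iff)
    ultimately show "insert A P
        \<in> {P \<in> subpartitions S k (Suc l). A \<in> P \<and> X \<subseteq> P - {A}}"
      using P assms notin[OF P(1)]
      by (auto simp: subpartitions_def pairwise_insert disjnt_sym)
  qed
qed

lemma card_subpartitions_containing_one:
  assumes "finite S" "k > 0" "A \<subseteq> S" "card A = k"
  shows "card {P \<in> subpartitions S k (Suc l). A \<in> P} = card (subpartitions (S - A) k l)"
  using card_subpartitions_containing[OF assms, of l "{}"] by simp

text \<open>Induction on \<open>l\<close>, counting pairs of a subpartition and one of its classes
  in two ways. The factorial on the left avoids division. If \<open>k * l\<close> exceeds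
  \<open>card S\<close>, the last factor is 0, in agreement with there being no
  subpartition.\<close>

lemma card_subpartitions:
  assumes "finite S" "k > 0"
  shows "fact l * card (subpartitions S k l) = (\<Prod>i<l. (card S - i * k) choose k)"
  using assms(1)
proof (induction l arbitrary: S)
  case 0
  have "P = {}" if "P \<in> subpartitions S k 0" for P
    using finite_subpartition[OF 0 that] that by (simp add: subpartitions_def)
  moreover have "{} \<in> subpartitions S k 0" by (simp add: subpartitions_def)
  ultimately have "subpartitions S k 0 = {{}}" by blast
  then show ?case by simp
next
  case (Suc l)
  define K where "K = {A. A \<subseteq> S \<and> card A = k}"
  define T where "T = subpartitions S k (Suc l)"
  have "finite K" using Suc.prems by (simp add: K_def)
  have "finite T" using Suc.prems finite_subpartitions by (auto simp: T_def)
  \<comment> \<open>Every class of \<open>P\<close> is one of the \<open>k\<close>-subsets collected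
    in \<open>K\<close>, so each inner count is the number of classes.\<close>
  have "Suc l * card T = (\<Sum>P\<in>T. card {A \<in> K. A \<in> P})"
  proof -
    have "{A \<in> K. A \<in> P} = P" if "P \<in> T" for P
      using that by (auto simp: T_def K_def subpartitions_def)
    then have "card {A \<in> K. A \<in> P} = Suc l" if "P \<in> T" for P
      using that by (simp add: T_def subpartitions_def)
    then show ?thesis by simp
  qed
  also have "\<dots> = (\<Sum>A\<in>K. card {P \<in> T. A \<in> P})"
    using sum_multicount_gen[OF \<open>finite T\<close> \<open>finite K\<close>, where R = "\<lambda>P A. A \<in> P"] by auto
  also have "\<dots> = (\<Sum>A\<in>K. card (subpartitions (S - A) k l))"
    using card_subpartitions_containing_one[OF Suc.prems assms(2)]
    by (intro sum.cong) (auto simp: K_def T_def)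
  finally have "fact (Suc l) * card T = (\<Sum>A\<in>K. fact l * card (subpartitions (S - A) k l))"
    by (simp only: sum_distrib_left[symmetric] fact_Suc of_nat_id ac_simps)
  also have "\<dots> = (\<Sum>A\<in>K. \<Prod>i<l. (card S - Suc i * k) choose k)"
  proof (rule sum.cong)
    fix A assume "A \<in> K"
    then have "card (S - A) = card S - k"
      using finite_subset[OF _ Suc.prems, of A] by (simp add: K_def card_Diff_subset)
    then show "fact l * card (subpartitions (S - A) k l)
        = (\<Prod>i<l. (card S - Suc i * k) choose k)"
      using Suc.IH[of "S - A"] Suc.prems by simp
  qed simp
  also have "\<dots> = (card S choose k) * (\<Prod>i<l. (card S - Suc i * k) choose k)"
    using n_subsets[OF Suc.prems] by (simp add: K_def)
  finally show ?case
    by (simp only: T_def prod.lessThan_Suc_shift mult_0 diff_zero)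
qed

text \<open>Deleting \<open>A\<close> and then \<open>B\<close> leaves the subpartitions of a set
  with \<open>2 * k\<close> fewer points, which are already counted.\<close>

lemma card_subpartitions_containing_two:
  assumes "finite S" "k > 0" "A \<subseteq> S" "card A = k" "B \<subseteq> S" "card B = k" "disjnt A B"
  shows "fact l * card {P \<in> subpartitions S k (Suc (Suc l)). A \<in> P \<and> B \<in> P}
       = (\<Prod>i<l. (card S - 2 * k - i * k) choose k)"
proof -
  have "A \<noteq> B" using assms by auto
  then have "{P \<in> subpartitions S k (Suc (Suc l)). A \<in> P \<and> B \<in> P}
           = {P \<in> subpartitions S k (Suc (Suc l)). A \<in> P \<and> {B} \<subseteq> P - {A}}"
    by auto
  then have "card {P \<in> subpartitions S k (Suc (Suc l)). A \<in> P \<and> B \<in> P}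
           = card {P \<in> subpartitions (S - A) k (Suc l). B \<in> P}"
    using card_subpartitions_containing[OF assms(1-4), of "Suc l" "{B}"] by simp
  also have "\<dots> = card (subpartitions (S - A - B) k l)"
    using assms by (intro card_subpartitions_containing_one) (auto simp: disjnt_iff)
  finally have eq: "card {P \<in> subpartitions S k (Suc (Suc l)). A \<in> P \<and> B \<in> P}
      = card (subpartitions (S - A - B) k l)" .
  have "card (S - A - B) = card S - 2 * k"
  proof -
    have "finite A" "finite B" using assms finite_subset by blast+
    moreover have "B \<subseteq> S - A" using assms by (auto simp: disjnt_iff)
    ultimately show ?thesis using assms by (simp add: card_Diff_subset)
  qed
  then show ?thesis
    using card_subpartitions[of "S - A - B" k l] assms eq by simp
qed

section \<open>Classes disjoint from a given set\<close>

lemma card_Union_subpartition: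
  assumes "finite S" "P \<in> subpartitions S k l"
  shows "card (\<Union>P) = k * l"
proof -
  have "card (\<Union>P) = sum card P"
    using assms finite_subset[OF _ assms(1)]
    by (intro card_Union_disjoint) (auto simp: subpartitions_def pairwise_def disjnt_def)
  also have "\<dots> = k * l" using assms by (simp add: subpartitions_def)
  finally show ?thesis .
qed

text \<open>If all classes of \<open>Q\<close> avoided \<open>A\<close>, they would occupy
  \<open>k * Suc l\<close> points together with \<open>A\<close>, more than \<open>S\<close>
  has.\<close>

lemma card_disjoint_classes_less:
  assumes "finite S" "card S < k * Suc l" "Q \<in> subpartitions S k l" "A \<subseteq> S" "card A = k"
  shows "card {B \<in> Q. disjnt A B} < l"
proof (rule ccontr)
  assume "\<not> ?thesis"
  moreover have "finite Q" using assms finite_subpartition by blast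
  moreover have "card Q = l" using assms by (simp add: subpartitions_def)
  ultimately have "{B \<in> Q. disjnt A B} = Q"
    by (intro card_subset_eq) (auto intro: antisym card_mono)
  then have "A \<inter> \<Union>Q = {}" by (auto simp: disjnt_iff)
  moreover have sub: "A \<union> \<Union>Q \<subseteq> S" using assms by (auto simp: subpartitions_def)
  ultimately have "card (A \<union> \<Union>Q) = k + k * l"
    using card_Union_subpartition[OF assms(1,3)] assms finite_subset[OF sub]
    by (simp add: card_Un_disjoint)
  moreover have "card (A \<union> \<Union>Q) \<le> card S" using sub assms(1) card_mono by blast
  ultimately show False using assms(2) by simp
qed

text \<open>Here the classes of \<open>Q\<close> cover \<open>S\<close>. If \<open>A\<close> met
  only one of them, it would lie inside it and equal it by cardinality; hence \<open>A\<close> meets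
  at least two.\<close>

lemma card_disjoint_classes_less_partition:
  assumes "finite S" "card S = k * l" "k > 0" "Q \<in> subpartitions S k l"
    and "A \<subseteq> S" "card A = k" "A \<notin> Q"
  shows "Suc (card {B \<in> Q. disjnt A B}) < l"
proof (rule ccontr)
  assume neg: "\<not> ?thesis"
  have "finite Q" using assms finite_subpartition by blast
  have "card Q = l" using assms by (simp add: subpartitions_def)
  have "\<Union>Q = S"
    using assms card_Union_subpartition[OF assms(1,4)]
    by (intro card_subset_eq) (auto simp: subpartitions_def)
  have "card (Q - {B \<in> Q. disjnt A B}) \<le> 1"
    using neg \<open>finite Q\<close> \<open>card Q = l\<close> by (subst card_Diff_subset) auto
  then have uniq: "B = C" if "B \<in> Q" "C \<in> Q" "\<not> disjnt A B" "\<not> disjnt A C" for B C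
    using that \<open>finite Q\<close> by (subst (asm) card_le_Suc0_iff_eq[unfolded One_nat_def[symmetric]]) auto
  have "A \<noteq> {}" using assms by auto
  then obtain x where "x \<in> A" by auto
  then obtain B where B: "x \<in> B" "B \<in> Q" using \<open>\<Union>Q = S\<close> assms by blast
  have "A \<subseteq> B"
  proof
    fix y assume "y \<in> A"
    then obtain C where "y \<in> C" "C \<in> Q" using \<open>\<Union>Q = S\<close> assms by blast
    then show "y \<in> B" using uniq[of B C] B \<open>x \<in> A\<close> \<open>y \<in> A\<close> by (auto simp: disjnt_iff)
  qed
  moreover have "card B = k" "finite B"
    using B assms finite_subset[OF _ assms(1)] by (auto simp: subpartitions_def)
  ultimately have "A = B" using assms by (intro card_subset_eq) auto
  then show False using B assms by simp
qed

section \<open>The numerical inequality\<close>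

text \<open>Raising the lower index by one raises the upper one by \<open>m\<close>: Pascal's rule
  accounts for one unit, monotonicity for the others. This reduces general \<open>k\<close> to
  \<open>k = 3\<close>.\<close>

lemma binomial_diagonal_mono:
  fixes k m r :: nat
  assumes "m \<ge> 1" "j \<le> k"
  shows "(j * m + r) choose j \<le> (k * m + r) choose k"
  using assms(2)
proof (induction k rule: dec_induct)
  case (step k)
  have "(k * m + r) choose k \<le> Suc (k * m + r) choose Suc k" by simp
  also have "\<dots> \<le> (Suc k * m + r) choose Suc k"
    using assms(1) by (intro binomial_right_mono) auto
  finally show ?case using step by simp
qed simp

lemma six_times_choose_three: "6 * (Suc (Suc (Suc a)) choose 3) = (a + 3) * (a + 2) * (a + 1)"
proof -
  have 3: "3 * (Suc (Suc (Suc a)) choose 3) = (a + 3) * (Suc (Suc a) choose 2)"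
    using Suc_times_binomial[of 2 "Suc (Suc a)"] by (simp add: numeral_3_eq_3 numeral_2_eq_2)
  have 2: "2 * (Suc (Suc a) choose 2) = (a + 2) * (a + 1)"
    using Suc_times_binomial[of 1 "Suc a"] by (simp add: numeral_2_eq_2)
  have "6 * (Suc (Suc (Suc a)) choose 3) = 2 * (3 * (Suc (Suc (Suc a)) choose 3))" by simp
  also have "\<dots> = (a + 3) * (2 * (Suc (Suc a) choose 2))" by (simp only: 3 mult.left_commute)
  also have "\<dots> = (a + 3) * (a + 2) * (a + 1)" by (simp only: 2 mult.assoc)
  finally show ?thesis .
qed

text \<open>After the reduction to \<open>k = 3\<close> a cubic inequality in \<open>l\<close>
  remains. The restrictions on \<open>d\<close> are sharp for \<open>k = 3\<close>,
  \<open>l = 2\<close>: the claim reads \<open>2 * d < 1\<close> for \<open>n = 6\<close> and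
  \<open>2 * d < 4\<close> for \<open>n = 7\<close>.\<close>

lemma disjoint_classes_bound:
  fixes n k l d :: nat
  assumes "k \<ge> 3" "l \<ge> 2" "k * l \<le> n" "d \<le> l"
    and "n < k * Suc l \<Longrightarrow> d < l"
    and "n = k * l \<Longrightarrow> Suc d < l"
  shows "l * (l - 1) * d < (n - k) choose k"
proof -
  obtain p where l: "l = p + 2" using assms(2) by (metis le_iff_add add.commute)
  \<comment> \<open>Here \<open>r\<close> bounds the excess \<open>n - k * l\<close> from below and
    \<open>e\<close> bounds \<open>d\<close> from above; the first premise is six times the
    inequality for \<open>k = 3\<close>.\<close>
  have main: "6 * (l * (l - 1) * e) < (3 * p + r + 3) * (3 * p + r + 2) * (3 * p + r + 1)
      \<Longrightarrow> d \<le> e \<Longrightarrow> k * l + r \<le> n \<Longrightarrow> ?thesis" for r e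
  proof -
    assume poly: "6 * (l * (l - 1) * e) < (3 * p + r + 3) * (3 * p + r + 2) * (3 * p + r + 1)"
      and "d \<le> e" and n: "k * l + r \<le> n"
    have "(3 * p + r + 3) * (3 * p + r + 2) * (3 * p + r + 1)
        = 6 * ((3 * Suc p + r) choose 3)"
    proof -
      have "3 * Suc p + r = Suc (Suc (Suc (3 * p + r)))" by simp
      then show ?thesis by (simp only: six_times_choose_three)
    qed
    then have "l * (l - 1) * e < (3 * Suc p + r) choose 3" using poly by simp
    also have "\<dots> \<le> (k * Suc p + r) choose k"
      using assms(1) by (intro binomial_diagonal_mono) auto
    also have "\<dots> \<le> (n - k) choose k"
      using n l by (intro binomial_right_mono) (simp add: algebra_simps)
    finally show ?thesis
      using mult_le_mono2[OF \<open>d \<le> e\<close>, of "l * (l - 1)"] by linarith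
  qed
  consider "n = k * l" | "n = k * l + 1" | "k * l + 2 \<le> n" using assms(3) by linarith
  then show ?thesis
  proof cases
    case 1
    then show ?thesis using assms(6) l by (intro main[of p 0]) (auto simp: algebra_simps)
  next
    case 2
    then show ?thesis using assms(1,5) l by (intro main[of "p + 1" 1]) (auto simp: algebra_simps)
  next
    case 3
    then show ?thesis using assms(4) l by (intro main[of "p + 2" 2]) (auto simp: algebra_simps)
  qed
qed

section \<open>Families without a common class\<close>

text \<open>Two union bounds: over the classes \<open>A\<close> of one member, then over the classes
  disjoint from \<open>A\<close> of a member avoiding \<open>A\<close>. Writing the number of
  classes as \<open>Suc (Suc l)\<close> leaves \<open>l\<close> classes once two are
  prescribed.\<close>

lemma card_noncanonical_family:
  assumes "finite S" "k > 0" "F \<subseteq> subpartitions S k (Suc (Suc l))"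
    and inter: "\<And>P Q. P \<in> F \<Longrightarrow> Q \<in> F \<Longrightarrow> P \<inter> Q \<noteq> {}"
    and no_common: "\<And>A. A \<subseteq> S \<Longrightarrow> card A = k \<Longrightarrow> \<exists>Q\<in>F. A \<notin> Q"
    and d: "\<And>Q A. Q \<in> F \<Longrightarrow> A \<subseteq> S \<Longrightarrow> card A = k \<Longrightarrow> A \<notin> Q \<Longrightarrow> card {B \<in> Q. disjnt A B} \<le> d"
  shows "fact l * card F \<le> Suc (Suc l) * d * (\<Prod>i<l. (card S - 2 * k - i * k) choose k)"
proof (cases "F = {}")
  case False
  \<comment> \<open>This is \<open>fact l\<close> times the number of subpartitions with two
    prescribed disjoint classes.\<close>
  define N where "N = (\<Prod>i<l. (card S - 2 * k - i * k) choose k)"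
  have fin: "finite F" using assms finite_subpartitions finite_subset by metis
  have star: "fact l * card {P \<in> F. A \<in> P} \<le> d * N" if A: "A \<subseteq> S" "card A = k" for A
  proof -
    obtain Q where Q: "Q \<in> F" "A \<notin> Q" using no_common A by blast
    define D where "D = {B \<in> Q. disjnt A B}"
    have QS: "Q \<in> subpartitions S k (Suc (Suc l))" using Q assms(3) by blast
    have "finite D" using finite_subpartition[OF assms(1) QS] by (simp add: D_def)
    \<comment> \<open>A class \<open>B\<close> shared by \<open>P\<close> and \<open>Q\<close>
      differs from \<open>A\<close>, since \<open>Q\<close> avoids \<open>A\<close>; as both are
      classes of \<open>P\<close>, they are disjoint.\<close>
    have "{P \<in> F. A \<in> P} \<subseteq> (\<Union>B\<in>D. {P \<in> F. A \<in> P \<and> B \<in> P})"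
    proof
      fix P assume P: "P \<in> {P \<in> F. A \<in> P}"
      then obtain B where B: "B \<in> P" "B \<in> Q" using inter[of P Q] Q by auto
      then have "disjnt A B"
        using P Q assms(3) by (force simp: subpartitions_def pairwise_def)
      then show "P \<in> (\<Union>B\<in>D. {P \<in> F. A \<in> P \<and> B \<in> P})" using P B by (auto simp: D_def)
    qed
    then have "card {P \<in> F. A \<in> P} \<le> card (\<Union>B\<in>D. {P \<in> F. A \<in> P \<and> B \<in> P})"
      using fin \<open>finite D\<close> by (intro card_mono) auto
    also have "\<dots> \<le> (\<Sum>B\<in>D. card {P \<in> F. A \<in> P \<and> B \<in> P})"
      using card_UN_le[OF \<open>finite D\<close>] by blast
    finally have "fact l * card {P \<in> F. A \<in> P}
        \<le> (\<Sum>B\<in>D. fact l * card {P \<in> F. A \<in> P \<and> B \<in> P})"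
      by (simp only: sum_distrib_left[symmetric] mult_le_mono2)
    also have "\<dots> \<le> (\<Sum>B\<in>D. N)"
    proof (rule sum_mono)
      fix B assume "B \<in> D"
      then have B: "B \<subseteq> S" "card B = k" "disjnt A B"
        using QS by (auto simp: D_def subpartitions_def)
      have "card {P \<in> F. A \<in> P \<and> B \<in> P}
          \<le> card {P \<in> subpartitions S k (Suc (Suc l)). A \<in> P \<and> B \<in> P}"
        using assms(3) finite_subpartitions[OF assms(1)] by (intro card_mono) auto
      from mult_le_mono2[OF this, of "fact l"]
      show "fact l * card {P \<in> F. A \<in> P \<and> B \<in> P} \<le> N"
        by (simp only: card_subpartitions_containing_two[OF assms(1,2) A B] N_def)
    qed
    also have "\<dots> \<le> d * N" using d[OF Q(1) A Q(2)] by (simp add: D_def)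
    finally show ?thesis .
  qed
  obtain P0 where P0: "P0 \<in> F" using False by blast
  then have P0S: "P0 \<in> subpartitions S k (Suc (Suc l))" using assms(3) by blast
  have "F \<subseteq> (\<Union>A\<in>P0. {P \<in> F. A \<in> P})" using inter[OF P0] by blast
  then have "card F \<le> card (\<Union>A\<in>P0. {P \<in> F. A \<in> P})"
    using fin finite_subpartition[OF assms(1) P0S] by (intro card_mono) auto
  also have "\<dots> \<le> (\<Sum>A\<in>P0. card {P \<in> F. A \<in> P})"
    using card_UN_le finite_subpartition[OF assms(1) P0S] by blast
  finally have "fact l * card F \<le> (\<Sum>A\<in>P0. fact l * card {P \<in> F. A \<in> P})"
    by (simp only: sum_distrib_left[symmetric] mult_le_mono2)
  also have "\<dots> \<le> (\<Sum>A\<in>P0. d * N)"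
    using P0S by (intro sum_mono star) (auto simp: subpartitions_def)
  also have "\<dots> = Suc (Suc l) * d * N"
    using P0S by (simp add: subpartitions_def algebra_simps)
  finally show ?thesis by (simp add: N_def)
qed simp

lemma card_noncanonical_family_less:
  assumes "finite S" "k \<ge> 3" "l \<ge> 2" "k * l \<le> card S" "F \<subseteq> subpartitions S k l"
    and "\<And>P Q. P \<in> F \<Longrightarrow> Q \<in> F \<Longrightarrow> P \<inter> Q \<noteq> {}"
    and "\<And>A. A \<subseteq> S \<Longrightarrow> card A = k \<Longrightarrow> \<exists>Q\<in>F. A \<notin> Q"
  shows "fact (l - 1) * card F < (\<Prod>i = 1..l - 1. (card S - i * k) choose k)"
proof -
  obtain m where l: "l = Suc (Suc m)" using assms(3) by (metis numeral_2_eq_2 Suc_le_D Suc_le_mono)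
  \<comment> \<open>The middle value applies whenever \<open>S\<close> has no room for
    \<open>l + 1\<close> disjoint \<open>k\<close>-sets, not just for an excess of one
    point.\<close>
  define d where
    "d = (if card S = k * l then l - 2 else if card S < k * Suc l then l - 1 else l)"
  define N where "N = (\<Prod>i<m. (card S - 2 * k - i * k) choose k)"
  have "card {B \<in> Q. disjnt A B} \<le> d"
    if "Q \<in> F" and A: "A \<subseteq> S" "card A = k" "A \<notin> Q" for Q A
  proof -
    have Q: "Q \<in> subpartitions S k l" using that assms(5) by blast
    have "card {B \<in> Q. disjnt A B} \<le> card Q"
      using finite_subpartition[OF assms(1) Q] by (intro card_mono) auto
    then have "card {B \<in> Q. disjnt A B} \<le> l" using Q by (simp add: subpartitions_def)
    then show ?thesis
      using card_disjoint_classes_less[OF assms(1) _ Q A(1,2)]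
        card_disjoint_classes_less_partition[OF assms(1) _ _ Q A] assms(2)
      unfolding d_def by force
  qed
  then have F: "fact m * card F \<le> l * d * N"
    using card_noncanonical_family[of S k F m d] assms unfolding l N_def by auto
  have less: "l * (l - 1) * d < (card S - k) choose k"
    using assms(2,3,4) by (intro disjoint_classes_bound) (auto simp: d_def)
  \<comment> \<open>Positivity keeps the inequality strict after multiplication by \<open>N\<close>.
    The last index is \<open>m - 1 = l - 3\<close>, so each upper entry is still at least
    \<open>k\<close>.\<close>
  have pos: "N > 0"
    unfolding N_def
  proof (intro prod_pos)
    fix i assume "i \<in> {..<m}"
    then have "k * (i + 3) \<le> k * l" using l by (intro mult_le_mono2) auto
    then show "(card S - 2 * k - i * k) choose k > 0"
      using assms(4) by (simp add: algebra_simps)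
  qed
  have "fact (l - 1) * card F = Suc m * (fact m * card F)"
    by (simp add: l algebra_simps)
  also have "\<dots> \<le> Suc m * (l * d * N)" using F mult_le_mono2 by blast
  also have "\<dots> = l * (l - 1) * d * N"
    by (simp add: l algebra_simps)
  also have "\<dots> < ((card S - k) choose k) * N" using less pos by simp
  \<comment> \<open>The factor \<open>(card S - k) choose k\<close> is the term of index 0, and
    \<open>N\<close> supplies the others after an index shift.\<close>
  also have "\<dots> = (\<Prod>i<Suc m. (card S - Suc i * k) choose k)"
  proof -
    have "card S - 2 * k - i * k = card S - Suc (Suc i) * k" for i by simp
    then have "N = (\<Prod>i<m. (card S - Suc (Suc i) * k) choose k)" by (simp only: N_def)
    then show ?thesis by (simp only: prod.lessThan_Suc_shift mult_1 One_nat_def[symmetric])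
  qed
  also have "\<dots> = (\<Prod>i = 1..l - 1. (card S - i * k) choose k)"
    using prod.shift_bounds_Suc_ivl[of "\<lambda>i. (card S - i * k) choose k" 0 "Suc m"]
    by (simp only: l lessThan_atLeast0 atLeastLessThanSuc_atLeastAtMost diff_Suc_Suc minus_nat.diff_0 One_nat_def)
  finally show ?thesis .
qed

section \<open>The bound and the case of equality\<close>

theorem theorem1:
  fixes n k l :: nat and F :: "nat set set set"
  assumes "n \<ge> 1" and "k * l \<le> n" and "l \<ge> 2" and "k \<ge> 3"
    and "\<forall>P\<in>F. subpartition n k l P"
    and "intersecting_family F"
  shows "real (card F) \<le> 1 / fact (l - 1) * (\<Prod>i = 1..l - 1. real ((n - i * k) choose k)) \<and>
    (real (card F) = 1 / fact (l - 1) * (\<Prod>i = 1..l - 1. real ((n - i * k) choose k))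
      \<longrightarrow> canonical_family n k l F)"
proof -
  define B where "B = (\<Prod>i = 1..l - 1. (n - i * k) choose k)"
  have B: "1 / fact (l - 1) * (\<Prod>i = 1..l - 1. real ((n - i * k) choose k))
      = real B / fact (l - 1)"
    by (simp add: B_def)
  have F: "F \<subseteq> subpartitions {1..n} k l" using assms(5) by (auto simp: subpartition_iff)
  \<comment> \<open>Clearing the factorial turns both claims into statements about natural
    numbers.\<close>
  have le: "real (card F) \<le> real B / fact (l - 1) \<longleftrightarrow> fact (l - 1) * card F \<le> B"
    and eq: "real (card F) = real B / fact (l - 1) \<longleftrightarrow> fact (l - 1) * card F = B"
  proof -
    have *: "real (fact (l - 1) * card F) = real (card F) * fact (l - 1)" by simp
    show "real (card F) \<le> real B / fact (l - 1) \<longleftrightarrow> fact (l - 1) * card F \<le> B"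
      by (simp only: pos_le_divide_eq[OF fact_gt_zero] *[symmetric] of_nat_le_iff)
    show "real (card F) = real B / fact (l - 1) \<longleftrightarrow> fact (l - 1) * card F = B"
      by (simp only: nonzero_eq_divide_eq[OF fact_nonzero] *[symmetric] of_nat_eq_iff)
  qed
  show ?thesis
  proof (cases "\<exists>A. A \<subseteq> {1..n} \<and> card A = k \<and> (\<forall>P\<in>F. A \<in> P)")
    case True
    then obtain A where A: "A \<subseteq> {1..n}" "card A = k" and common: "\<forall>P\<in>F. A \<in> P" by blast
    \<comment> \<open>This is the canonical family of \<open>A\<close>; \<open>Suc (l - 1)\<close>
      is \<open>l\<close>, in the form that the counting lemma expects. Equality will force
      \<open>F = C\<close> because \<open>C\<close> is finite.\<close>
    define C where "C = {P \<in> subpartitions {1..n} k (Suc (l - 1)). A \<in> P}"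
    have "finite C" by (simp add: C_def finite_subpartitions)
    have "F \<subseteq> C" using F common assms(3) by (auto simp: C_def)
    have "card ({1..n} - A) = n - k"
      using A finite_subset[OF A(1)] by (simp add: card_Diff_subset)
    then have "fact (l - 1) * card C = (\<Prod>i<l - 1. (n - Suc i * k) choose k)"
      using card_subpartitions[of "{1..n} - A" k "l - 1"] assms(4)
        card_subpartitions_containing_one[of "{1..n}" k A "l - 1"] A
      by (simp add: C_def)
    also have "\<dots> = B"
      using prod.shift_bounds_Suc_ivl[of "\<lambda>i. (n - i * k) choose k" 0 "l - 1"]
      by (simp add: B_def lessThan_atLeast0 atLeastLessThanSuc_atLeastAtMost)
    finally have C: "fact (l - 1) * card C = B" .
    have "card F \<le> card C" using \<open>F \<subseteq> C\<close> \<open>finite C\<close> card_mono by blast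
    then have "fact (l - 1) * card F \<le> B" using C mult_le_mono2 by metis
    moreover have "canonical_family n k l F" if "fact (l - 1) * card F = B"
    proof -
      have "card F = card C" using that C by (metis fact_nonzero mult_cancel1)
      then have "F = C" using \<open>F \<subseteq> C\<close> \<open>finite C\<close> card_subset_eq by blast
      then show ?thesis
        using A assms(3) by (auto simp: canonical_family_def C_def subpartition_iff)
    qed
    ultimately show ?thesis unfolding B using le eq by blast
  next
    \<comment> \<open>The bound is strict here, so the claim about equality holds vacuously.\<close>
    case False
    have "fact (l - 1) * card F < (\<Prod>i = 1..l - 1. (card {1..n} - i * k) choose k)"
    proof (rule card_noncanonical_family_less)
      show "P \<inter> Q \<noteq> {}" if "P \<in> F" "Q \<in> F" for P Q
        using assms(6) that
        by (auto simp: intersecting_family_def intersecting_subpartitions_def)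
      show "\<exists>Q\<in>F. A \<notin> Q" if "A \<subseteq> {1..n}" "card A = k" for A
        using False that by blast
    qed (use F assms in auto)
    then have "fact (l - 1) * card F < B" by (simp add: B_def)
    then show ?thesis unfolding B using le eq by simp
  qed
qed

end
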